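(* (1) If $G$ is a perfect finite group (in the sense that $\sum_{N \trianglelefteq G} |N| = 2|G|$), then any abelian quotient of $G$ is cyclic. (2) The perfect finite abelian groups are, up to isomorphism, precisely the cyclic groups $C_n$ of order $n$ with $n$ a perfect number. That is, a finite abelian group $A$ is perfect if and only if $A \cong C_n$ for some perfect number $n$.
   Context: For a finite group $G$, $D(G) = \sum_{N \trianglelefteq G} |N|$ denotes the sum of the orders of all normal subgroups of $G$ (including the trivial subgroup and $G$ itself). A finite group $G$ is called perfect if $D(G) = 2|G|$ (this is not the standard meaning of "perfect group"). A positive integer $n$ is perfect if the sum of all its positive divisors (including $n$) equals $2n$. $C_n$ denotes the cyclic group of order $n$. An abelian quotient of $G$ is an abelian group $A$ for which there exists a surjective homomorphism $G \to A$; equivalently, an abelian group isomorphic to $G/K$ for some normal subgroup $K$ of $G$. *)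

theory Defs
  imports "HOL-Algebra.Algebra"
begin

definition normal_order_sum :: "('a, 'm) monoid_scheme \<Rightarrow> nat" where
  "normal_order_sum G = (\<Sum>N | N \<lhd> G. card N)"

text \<open>``Perfect'' here is the divisor-sum analogue, not the condition that \<open>G\<close> equals its
  commutator subgroup.\<close>

definition perfect_finite_group :: "('a, 'm) monoid_scheme \<Rightarrow> bool" where
  "perfect_finite_group G \<longleftrightarrow>
     group G \<and> finite (carrier G) \<and> normal_order_sum G = 2 * order G"

text \<open>Positivity must be explicit: the set of divisors of \<open>0\<close> is infinite, so its sum is \<open>0\<close>
  by convention.\<close>

definition perfect_number :: "nat \<Rightarrow> bool" where
  "perfect_number n \<longleftrightarrow> n > 0 \<and> (\<Sum>d | d dvd n. d) = 2 * n"

definition abelian_quotient :: "('a, 'm) monoid_scheme \<Rightarrow> ('b, 'k) monoid_scheme \<Rightarrow> bool" where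
  "abelian_quotient G A \<longleftrightarrow> comm_group A \<and> (\<exists>f. f \<in> epi G A)"

end

theory Submission
  imports Defs
begin

text \<open>If \<open>f\<close> maps \<open>G\<close> onto a noncyclic abelian group, then the preimages of the cyclic
  subgroups \<open>\<langle>f g\<rangle>\<close> are proper normal subgroups of \<open>G\<close> that cover \<open>G\<close>. Even without the kernel
  they cover \<open>G\<close>, so the proper normal subgroups have total order greater than \<open>|G|\<close>, and \<open>G\<close> is
  not perfect. For cyclic \<open>G\<close> of order \<open>n\<close>, taking orders is a bijection from the subgroups to
  the divisors of \<open>n\<close>, so the sum is the divisor sum of \<open>n\<close>.\<close>

lemma (in group_hom) normal_preimage:
  assumes "N \<lhd> H"
  shows "{g \<in> carrier G. h g \<in> N} \<lhd> G"
proof -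
  have "subgroup N H" and conj: "\<And>x y. \<lbrakk>x \<in> carrier H; y \<in> N\<rbrakk> \<Longrightarrow> x \<otimes>\<^bsub>H\<^esub> y \<otimes>\<^bsub>H\<^esub> inv\<^bsub>H\<^esub> x \<in> N"
    using H.normal_invE[OF assms] by auto
  then interpret N: subgroup N H
    by simp
  show ?thesis
  proof (rule G.normal_invI)
    show "subgroup {g \<in> carrier G. h g \<in> N} G"
      by (rule G.subgroupI) (auto intro: exI[of _ \<one>])
  qed (auto simp: conj)
qed

lemma normal_order_sum_gt:
  assumes "group G" "finite (carrier G)" and A: "comm_group A" "\<not> cyclic_group A"
    and f: "f \<in> epi G A"
  shows "normal_order_sum G > 2 * order G"
proof -
  interpret A: comm_group A
    by fact
  interpret f: group_hom G A f
    using assms by (auto simp: group_hom_def group_hom_axioms_def epi_def A.is_group)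
  have surj: "f ` carrier G = carrier A"
    using f by (simp add: epi_def)
  \<comment> \<open>Each \<open>P a\<close> is the preimage of the cyclic subgroup generated by
    \<open>a\<close>. It is normal because every subgroup of the abelian group \<open>A\<close> is
    normal, and proper because otherwise \<open>a\<close> would generate \<open>A\<close>.\<close>
  define P where "P a = {g \<in> carrier G. f g \<in> generate A {a}}" for a
  define K where "K = P \<one>\<^bsub>A\<^esub>"
  \<comment> \<open>As a set, \<open>S\<close> lists every preimage once, although different
    \<open>a\<close> may generate the same subgroup.\<close>
  define S where "S = P ` carrier A"
  have finS: "finite S"
    using surj assms(2) by (metis S_def finite_imageI)
  have normal_P: "P a \<lhd> G" if "a \<in> carrier A" for a
    unfolding P_def using that
    by (intro f.normal_preimage A.subgroup_imp_normal A.generate_is_subgroup) auto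
  have proper_P: "P a \<noteq> carrier G" if a: "a \<in> carrier A" for a
  proof
    assume "P a = carrier G"
    then have "carrier A \<subseteq> generate A {a}"
      unfolding P_def surj[symmetric] by blast
    then have "carrier A = generate A {a}"
      using a A.generate_incl[of "{a}"] by auto
    then show False
      using A(2) a A.generate_pow[OF a] by (auto simp: A.cyclic_group)
  qed
  have mem_P: "g \<in> P (f g)" if "g \<in> carrier G" for g
    using that by (auto simp: P_def intro: generate.incl)
  have K_eq: "K = {g \<in> carrier G. f g = \<one>\<^bsub>A\<^esub>}"
    by (auto simp: K_def P_def A.generate_one)
  have "K \<in> S"
    by (auto simp: K_def S_def)
  have "K \<noteq> carrier G"
    using proper_P by (simp add: K_def)
  then obtain x where x: "x \<in> carrier G" "f x \<noteq> \<one>\<^bsub>A\<^esub>"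
    by (auto simp: K_eq)
  \<comment> \<open>Outside the kernel \<open>K\<close>, \<open>P (f g)\<close> contains
    \<open>g\<close> and so differs from \<open>K\<close>. Inside \<open>K\<close>, the member
    \<open>P (f x)\<close> serves: it contains the kernel and also \<open>x\<close>, which
    \<open>K\<close> does not.\<close>
  have "\<exists>N\<in>S - {K}. g \<in> N" if g: "g \<in> carrier G" for g
  proof (cases "g \<in> K")
    case True
    then have "g \<in> P (f x)"
      by (auto simp: K_eq P_def intro: generate.one)
    moreover have "P (f x) \<noteq> K"
      using mem_P[OF x(1)] x by (auto simp: K_eq)
    ultimately show ?thesis
      using x by (auto simp: S_def)
  next
    case False
    then show ?thesis
      using mem_P[OF g] g by (auto simp: S_def)
  qed
  then have cover: "carrier G \<subseteq> (\<Union>N\<in>S - {K}. N)"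
    by auto
  have subS: "N \<subseteq> carrier G" if "N \<in> S" for N
    using that by (auto simp: S_def P_def)
  have "order G \<le> card (\<Union>N\<in>S - {K}. N)"
    unfolding order_def using finS subS
    by (intro card_mono cover) (auto intro: finite_subset[OF _ assms(2)])
  also have "\<dots> \<le> (\<Sum>N\<in>S - {K}. card N)"
    using finS by (intro card_UN_le) auto
  finally have 1: "order G \<le> (\<Sum>N\<in>S - {K}. card N)" .
  have "\<one>\<^bsub>G\<^esub> \<in> K"
    by (simp add: K_eq)
  then have "card K > 0"
    using subS[OF \<open>K \<in> S\<close>] finite_subset[OF _ assms(2)] by (auto simp: card_gt_0_iff)
  \<comment> \<open>The inequality becomes strict by putting back \<open>K\<close>, which has at
    least one element.\<close>
  then have 2: "order G < (\<Sum>N\<in>S. card N)"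
    using 1 by (simp add: sum.remove[OF finS \<open>K \<in> S\<close>])
  \<comment> \<open>The whole group is not in \<open>S\<close>, so it adds a further
    \<open>order G\<close> to the more than \<open>order G\<close> from \<open>S\<close>.\<close>
  have "(\<Sum>N\<in>insert (carrier G) S. card N) \<le> (\<Sum>N | N \<lhd> G. card N)"
  proof (rule sum_mono2)
    have "{N. N \<lhd> G} \<subseteq> Pow (carrier G)"
      by (auto dest!: normal_imp_subgroup subgroup.subset)
    then show "finite {N. N \<lhd> G}"
      using assms(2) finite_subset by blast
    show "insert (carrier G) S \<subseteq> {N. N \<lhd> G}"
      using normal_P f.G.normal_invI[OF f.G.subgroup_self] by (auto simp: S_def)
  qed auto
  moreover have "carrier G \<notin> S"
    using proper_P by (auto simp: S_def)
  ultimately show ?thesis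
    using 2 finS by (simp add: normal_order_sum_def order_def)
qed

lemma perfect_imp_abelian_quotient_cyclic:
  assumes "perfect_finite_group G" "abelian_quotient G A"
  shows "cyclic_group A"
  using assms normal_order_sum_gt[of G A]
  by (fastforce simp: perfect_finite_group_def abelian_quotient_def)

lemma (in group) cyclic_group_obtain_generator:
  assumes "cyclic_group G"
  obtains x where "x \<in> carrier G" "carrier G = range (\<lambda>n::int. x [^] n)" "ord x = order G"
proof -
  obtain x where x: "x \<in> carrier G" "carrier G = range (\<lambda>n::int. x [^] n)"
    using assms by (auto simp: cyclic_group)
  moreover have "generate G {x} = carrier G"
    using x by (auto simp: generate_pow)
  then have "ord x = order G"
    using generate_pow_card[OF x(1)] by (simp add: order_def)
  ultimately show thesis
    using that by blast
qed

text \<open>With k the index of \<open>N\<close>, the coset of \<open>x\<close> has trivial k-th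
  power in the quotient, which has order k. So x^k lies in \<open>N\<close>, and the subgroup it
  generates already has as many elements as \<open>N\<close>.\<close>

lemma (in group) generate_pow_index_eq_subgroup:
  assumes fin: "finite (carrier G)" and x: "x \<in> carrier G" "ord x = order G" and N: "N \<lhd> G"
  shows "generate G {x [^] (order G div card N)} = N"
proof -
  interpret N: normal N G
    by fact
  have NG: "subgroup N G"
    using N by (rule normal_imp_subgroup)
  have finN: "finite N"
    using N.subset fin finite_subset by blast
  then have "card N > 0"
    using N.one_closed by (metis card_gt_0_iff empty_iff)
  define k where "k = order G div card N"
  have k_rcosets: "k = card (rcosets N)"
    unfolding k_def lagrange[OF NG, symmetric] using \<open>card N > 0\<close> by simp
  then have kN: "k * card N = order G" and k: "k = order (G Mod N)"
    using lagrange[OF NG] by (simp, simp add: FactGroup_def order_def)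
  interpret Q: group "G Mod N"
    by (rule N.factorgroup_is_group)
  have "N #> x \<in> carrier (G Mod N)"
    using x by (auto simp: carrier_FactGroup)
  then have "N #> (x [^] k) = N"
    using Q.pow_order_eq_1[of "N #> x"] N.FactGroup_pow[OF x(1), of k] by (simp add: k)
  then have mem: "x [^] k \<in> N"
    using coset_join1[OF _ _ NG] x by auto
  have "order G > 0"
    using fin by (simp add: order_gt_0_iff_finite)
  then have "k > 0"
    using kN by (cases k) auto
  \<comment> \<open>The order of x^k is |G| / gcd(|G|, k), and k divides |G| with cofactor
    \<open>card N\<close>.\<close>
  have "card (generate G {x [^] k}) = card N"
    using x \<open>k > 0\<close> \<open>order G > 0\<close>
    by (simp flip: generate_pow_card add: ord_pow_gen) (simp flip: kN)
  moreover have "generate G {x [^] k} \<subseteq> N"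
    using mem NG by (intro generate_subgroup_incl) auto
  ultimately show ?thesis
    using finN card_subset_eq by (auto simp: k_def)
qed

lemma (in group) normal_order_sum_cyclic:
  assumes fin: "finite (carrier G)" and "cyclic_group G"
  shows "normal_order_sum G = (\<Sum>d | d dvd order G. d)"
proof -
  obtain x where x: "x \<in> carrier G" "ord x = order G"
    using assms cyclic_group_obtain_generator by metis
  interpret comm_group G
    by (rule cyclic_imp_abelian_group) fact
  have "order G > 0"
    using fin by (simp add: order_gt_0_iff_finite)
  have card_gen: "card (generate G {x [^] (order G div d)}) = d" if "d dvd order G" for d
  proof -
    obtain k where k: "order G = d * k"
      using \<open>d dvd order G\<close> by auto
    then have "d > 0" "k > 0"
      using \<open>order G > 0\<close> by auto
    then show ?thesis
      using x by (simp flip: generate_pow_card add: ord_pow_gen) (simp add: k)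
  qed
  show ?thesis
    unfolding normal_order_sum_def
  \<comment> \<open>The inverse of taking orders sends d to the subgroup generated by x^(|G|/d); it
    is normal since a cyclic group is abelian.\<close>
  proof (rule sum.reindex_bij_witness[where j = card
        and i = "\<lambda>d. generate G {x [^] (order G div d)}"])
    fix N assume "N \<in> {N. N \<lhd> G}"
    then have N: "N \<lhd> G"
      by simp
    show "generate G {x [^] (order G div card N)} = N"
      using fin x N by (rule generate_pow_index_eq_subgroup)
    show "card N \<in> {d. d dvd order G}"
      using lagrange[OF normal_imp_subgroup[OF N]] by (metis dvd_triv_right mem_Collect_eq)
  next
    fix d assume "d \<in> {d. d dvd order G}"
    then show "card (generate G {x [^] (order G div d)}) = d"
      using card_gen by simp
    show "generate G {x [^] (order G div d)} \<in> {N. N \<lhd> G}"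
      using x by (auto intro!: subgroup_imp_normal generate_is_subgroup)
  qed simp
qed

lemma (in group) cyclic_group_iso_integer_mod_group:
  assumes fin: "finite (carrier G)" and "cyclic_group G"
  shows "G \<cong> integer_mod_group (order G)"
proof -
  obtain x where x: "x \<in> carrier G" "carrier G = range (\<lambda>n::int. x [^] n)" "ord x = order G"
    using assms cyclic_group_obtain_generator by metis
  let ?n = "order G"
  have n: "?n > 0"
    using fin by (simp add: order_gt_0_iff_finite)
  have pow_mod: "x [^] (i mod int ?n) = x [^] i" for i :: int
    using x by (simp add: int_pow_eq mod_eq_dvd_iff[symmetric])
  let ?f = "\<lambda>i::int. x [^] i"
  have carr: "carrier (integer_mod_group ?n) = {0..<int ?n}"
    using n by (simp add: carrier_integer_mod_group)
  have "?f ` {0..<int ?n} = carrier G"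
  proof -
    have "x [^] i \<in> ?f ` {0..<int ?n}" for i :: int
      using pow_mod[of i] n by (intro image_eqI[of _ _ "i mod int ?n"]) auto
    then show ?thesis
      using x by auto
  qed
  \<comment> \<open>A map from n exponents onto a group of n elements is injective.\<close>
  moreover from this have "inj_on ?f {0..<int ?n}"
    by (intro eq_card_imp_inj_on) (auto simp: order_def)
  ultimately have "?f \<in> iso (integer_mod_group ?n) G"
    using x(1) by (auto intro!: isoI homI simp: carr bij_betw_def pow_mod int_pow_mult)
  then show ?thesis
    using group.iso_sym[OF group_integer_mod_group] is_isoI by blast
qed

lemma perfect_comm_group_iff:
  assumes "comm_group A" and fin: "finite (carrier A)"
  shows "perfect_finite_group A \<longleftrightarrow> (\<exists>n. perfect_number n \<and> A \<cong> integer_mod_group n)"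
proof
  interpret comm_group A
    by fact
  assume perfect: "perfect_finite_group A"
  \<comment> \<open>The identity makes \<open>A\<close> a quotient of itself, so the result on
    abelian quotients applies to \<open>A\<close>.\<close>
  have "abelian_quotient A A"
    using assms(1) iso_set_refl by (auto simp: abelian_quotient_def iso_iff_mon_epi)
  then have cyclic: "cyclic_group A"
    using perfect perfect_imp_abelian_quotient_cyclic by blast
  have "perfect_number (order A)"
    using perfect normal_order_sum_cyclic[OF fin cyclic] fin
    by (simp add: perfect_finite_group_def perfect_number_def order_gt_0_iff_finite)
  then show "\<exists>n. perfect_number n \<and> A \<cong> integer_mod_group n"
    using cyclic_group_iso_integer_mod_group[OF fin cyclic] by blast
next
  interpret comm_group A
    by fact
  assume "\<exists>n. perfect_number n \<and> A \<cong> integer_mod_group n"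
  then obtain n where n: "perfect_number n" and iso: "A \<cong> integer_mod_group n"
    by blast
  have "n > 0"
    using n by (simp add: perfect_number_def)
  then have "order A = n"
    using iso_same_card[OF iso] by (simp add: order_def carrier_integer_mod_group)
  moreover have "cyclic_group (integer_mod_group n)"
  proof -
    have "carrier (integer_mod_group n) = range (\<lambda>i::int. i mod int n)"
      using \<open>n > 0\<close> by (force simp: carrier_integer_mod_group image_iff intro: mod_pos_pos_trivial[symmetric])
    \<comment> \<open>The generator is \<open>1 mod int n\<close> rather than 1 because for n = 1
      the carrier is {0}.\<close>
    also have "\<dots> = range (\<lambda>i::int. (1 mod int n) [^]\<^bsub>integer_mod_group n\<^esub> i)"
      by (simp add: int_pow_integer_mod_group mod_mult_right_eq)
    finally show ?thesis
      unfolding group.cyclic_group[OF group_integer_mod_group]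
      using \<open>n > 0\<close> by (intro bexI[of _ "1 mod int n"]) (auto simp: carrier_integer_mod_group)
  qed
  then have "cyclic_group A"
    using isomorphic_group_cyclicity[OF iso] by simp
  ultimately show "perfect_finite_group A"
    using n normal_order_sum_cyclic[OF fin] fin
    by (simp add: perfect_finite_group_def perfect_number_def)
qed

theorem mainTheorem2:
  shows "(\<forall>(G :: ('a, 'm) monoid_scheme) (A :: ('b, 'k) monoid_scheme).
            perfect_finite_group G \<and> abelian_quotient G A \<longrightarrow> cyclic_group A)
       \<and> (\<forall>A :: ('c, 'l) monoid_scheme. comm_group A \<and> finite (carrier A) \<longrightarrow>
            (perfect_finite_group A \<longleftrightarrow> (\<exists>n. perfect_number n \<and> A \<cong> integer_mod_group n)))"
  using perfect_imp_abelian_quotient_cyclic perfect_comm_group_iff by blast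

end
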